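(* Let $n\ge1$ and let $(\xi_i,\mathcal{F}_i)_{i=0,\dots,n}$ be real-valued supermartingale differences with $S_k=\sum_{i=1}^k\xi_i$. Let $V_{i-1}$, $i\in[1,n]$, be positive $\mathcal{F}_{i-1}$-measurable random variables. Suppose that, for some $\lambda\in(0,\infty)$ and a positive function $f(\lambda)$, $$\mathbf{E}(e^{\lambda\xi_i}|\mathcal{F}_{i-1})\le\exp\{f(\lambda)V_{i-1}\}\quad\text{for all } i\in[1,n].$$ Then, for all $x,v>0$, $$\mathbf{P}\left(S_k\ge x\ \text{and}\ \sum_{i=1}^kV_{i-1}\le v^2\ \text{for some}\ k\in[1,n]\right)\le\exp\left\{-\lambda x+f(\lambda)v^2\right\}.$$
   Context: $(\xi_i,\mathcal{F}_i)_{i=0,\dots,n}$ is a sequence of real-valued supermartingale differences on a probability space $(\Omega,\mathcal{F},\mathbf{P})$: $\xi_0=0$, $\{\emptyset,\Omega\}=\mathcal{F}_0\subseteq\dots\subseteq\mathcal{F}_n\subseteq\mathcal{F}$ are increasing $\sigma$-fields, $\xi_i$ is $\mathcal{F}_i$-measurable, and $\mathbf{E}(\xi_i|\mathcal{F}_{i-1})\le 0$ for $i=1,\dots,n$. Here $i,k\in[1,n]$ denote integers. Inequalities between conditional expectations hold almost surely. *)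

theory Defs
  imports "HOL-Probability.Probability"
begin

text \<open>
  Only the indices \<open>0, \<dots>, n\<close> of \<open>F\<close> and \<open>\<xi>\<close> are constrained. Integrability is the standing
  assumption under which the conditional expectation of a real random variable is taken; without
  it \<^const>\<open>real_cond_exp\<close> need not be a conditional expectation.
\<close>

locale supermartingale_differences = prob_space M
  for M :: "'a measure" +
  fixes n :: nat
    and F :: "nat \<Rightarrow> 'a measure"
    and \<xi> :: "nat \<Rightarrow> 'a \<Rightarrow> real"
  assumes subalgebra_F: "\<And>i. i \<le> n \<Longrightarrow> subalgebra M (F i)"
    and sets_F_0: "sets (F 0) = {{}, space M}"
    and sets_F_mono: "\<And>i j. i \<le> j \<Longrightarrow> j \<le> n \<Longrightarrow> sets (F i) \<subseteq> sets (F j)"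
    and diff_0: "\<And>\<omega>. \<omega> \<in> space M \<Longrightarrow> \<xi> 0 \<omega> = 0"
    and diff_adapted: "\<And>i. i \<le> n \<Longrightarrow> \<xi> i \<in> borel_measurable (F i)"
    and diff_integrable: "\<And>i. i \<le> n \<Longrightarrow> integrable M (\<xi> i)"
    and cond_exp_diff_le_0:
      "\<And>i. i \<in> {1..n} \<Longrightarrow> AE \<omega> in M. real_cond_exp M (F (i - 1)) (\<xi> i) \<omega> \<le> 0"

end

theory Submission
  imports Defs
begin

text \<open>
  The process \<open>Z\<^sub>k = exp (\<lambda> S\<^sub>k - f \<lambda> (V\<^sub>0 + \<dots> + V\<^sub>k\<^sub>-\<^sub>1))\<close> is a nonnegative supermartingale with
  \<open>Z\<^sub>0 = 1\<close>, and on the event in question some \<open>Z\<^sub>k\<close> is at least \<open>exp (\<lambda> x - f \<lambda> v\<^sup>2)\<close>, so the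
  bound is Ville's maximal inequality.
\<close>

lemma nonneg_supermartingale_maximal_inequality:
  fixes Z :: "nat \<Rightarrow> 'a \<Rightarrow> ennreal" and F :: "nat \<Rightarrow> 'a measure" and c :: ennreal
  assumes sub: "\<And>i. i \<le> n \<Longrightarrow> subalgebra M (F i)"
    and mono: "\<And>i j. i \<le> j \<Longrightarrow> j \<le> n \<Longrightarrow> sets (F i) \<subseteq> sets (F j)"
    and adapted: "\<And>i. i \<le> n \<Longrightarrow> Z i \<in> borel_measurable (F i)"
    and super: "\<And>i A. i < n \<Longrightarrow> A \<in> sets (F i) \<Longrightarrow>
      (\<integral>\<^sup>+\<omega>\<in>A. Z (Suc i) \<omega> \<partial>M) \<le> (\<integral>\<^sup>+\<omega>\<in>A. Z i \<omega> \<partial>M)"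
  shows "c * emeasure M {\<omega> \<in> space M. \<exists>k\<le>n. c \<le> Z k \<omega>} \<le> (\<integral>\<^sup>+\<omega>. Z 0 \<omega> \<partial>M)"
proof -
  define G where "G k = {\<omega> \<in> space M. \<exists>j\<le>k. c \<le> Z j \<omega>}" for k
  have space_F: "space (F i) = space M" if "i \<le> n" for i
    using sub[OF that] by (simp add: subalgebra_def)
  have level_F: "{\<omega> \<in> space M. c \<le> Z j \<omega>} \<in> sets (F k)" if "j \<le> k" "k \<le> n" for j k
  proof -
    have j: "j \<le> n" using that by simp
    have "{\<omega> \<in> space (F j). c \<le> Z j \<omega>} \<in> sets (F j)"
      using adapted[OF j] by measurable
    then show ?thesis
      using mono[OF that] by (auto simp: space_F[OF j])
  qed
  \<comment> \<open>Membership in \<open>F k\<close>, not merely in \<open>M\<close>, is what later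
    allows \<open>super\<close> to be applied on the complement of \<open>G k\<close>.\<close>
  have G_F: "G k \<in> sets (F k)" if "k \<le> n" for k
  proof -
    have "G k = (\<Union>j\<in>{..k}. {\<omega> \<in> space M. c \<le> Z j \<omega>})"
      by (auto simp: G_def)
    then show ?thesis
      using level_F[OF _ that] by auto
  qed
  have sets_F_M: "A \<in> sets M" if "k \<le> n" "A \<in> sets (F k)" for k A
    using sub[OF that(1)] that(2) by (auto simp: subalgebra_def)
  have Z_M: "Z k \<in> borel_measurable M" if "k \<le> n" for k
    by (rule measurable_from_subalg[OF sub adapted]) (use that in auto)
  have markov: "c * emeasure M A \<le> (\<integral>\<^sup>+\<omega>\<in>A. Z k \<omega> \<partial>M)"
    if "A \<in> sets M" "\<And>\<omega>. \<omega> \<in> A \<Longrightarrow> c \<le> Z k \<omega>" for A k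
  proof -
    have "c * emeasure M A = (\<integral>\<^sup>+\<omega>. c * indicator A \<omega> \<partial>M)"
      using that(1) by (simp add: nn_integral_cmult_indicator)
    also have "\<dots> \<le> (\<integral>\<^sup>+\<omega>\<in>A. Z k \<omega> \<partial>M)"
      by (rule nn_integral_mono) (use that(2) in \<open>auto split: split_indicator\<close>)
    finally show ?thesis .
  qed
  have split: "(\<integral>\<^sup>+\<omega>\<in>A \<union> B. Z k \<omega> \<partial>M) = (\<integral>\<^sup>+\<omega>\<in>A. Z k \<omega> \<partial>M) + (\<integral>\<^sup>+\<omega>\<in>B. Z k \<omega> \<partial>M)"
    if "k \<le> n" "A \<in> sets M" "B \<in> sets M" "A \<inter> B = {}" for A B k
    by (rule nn_integral_disjoint_pair) (use that Z_M[OF that(1)] in auto)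
  \<comment> \<open>Induction needs the mass of \<open>Z k\<close> that has not yet crossed the level \<open>c\<close>.\<close>
  have "c * emeasure M (G k) + (\<integral>\<^sup>+\<omega>\<in>space M - G k. Z k \<omega> \<partial>M) \<le> (\<integral>\<^sup>+\<omega>. Z 0 \<omega> \<partial>M)"
    if "k \<le> n" for k
    using that
  proof (induction k)
    case 0
    have G0: "G 0 \<in> sets M" using sets_F_M[OF _ G_F[of 0]] by simp
    have "c * emeasure M (G 0) + (\<integral>\<^sup>+\<omega>\<in>space M - G 0. Z 0 \<omega> \<partial>M)
        \<le> (\<integral>\<^sup>+\<omega>\<in>G 0. Z 0 \<omega> \<partial>M) + (\<integral>\<^sup>+\<omega>\<in>space M - G 0. Z 0 \<omega> \<partial>M)"
      by (intro add_right_mono markov G0) (simp add: G_def)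
    also have "\<dots> = (\<integral>\<^sup>+\<omega>\<in>G 0 \<union> (space M - G 0). Z 0 \<omega> \<partial>M)"
      by (rule split[symmetric]) (use G0 in auto)
    also have "\<dots> = (\<integral>\<^sup>+\<omega>. Z 0 \<omega> \<partial>M)"
      by (rule nn_integral_cong) (auto split: split_indicator)
    finally show ?case .
  next
    case (Suc k)
    \<comment> \<open>\<open>?D\<close> is the event that the level is first reached at time
      \<open>Suc k\<close>. The mass of \<open>Z (Suc k)\<close> there pays for the growth of
      \<open>c * emeasure M (G k)\<close> to \<open>c * emeasure M (G (Suc k))\<close>.\<close>
    let ?D = "G (Suc k) - G k"
    have Gk: "G k \<in> sets M" using sets_F_M[OF _ G_F[of k]] Suc.prems by simp
    have GS: "G (Suc k) \<in> sets M" using sets_F_M[OF _ G_F[of "Suc k"]] Suc.prems by simp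
    have sub_G: "G k \<subseteq> G (Suc k)" by (auto simp: G_def intro: le_SucI)
    have eq: "space M - G k = ?D \<union> (space M - G (Suc k))"
      using sub_G sets.sets_into_space[OF GS] by auto
    have D: "c * emeasure M ?D \<le> (\<integral>\<^sup>+\<omega>\<in>?D. Z (Suc k) \<omega> \<partial>M)"
    proof (rule markov)
      show "?D \<in> sets M" using Gk GS by (rule sets.Diff[rotated])
      show "c \<le> Z (Suc k) \<omega>" if "\<omega> \<in> ?D" for \<omega>
        \<comment> \<open>Some index up to \<open>Suc k\<close> reaches \<open>c\<close> but none up
          to \<open>k\<close> does, so that index is \<open>Suc k\<close>.\<close>
        using that unfolding G_def by (auto simp only: le_Suc_eq)
    qed
    have "emeasure M (G (Suc k)) = emeasure M (G k) + emeasure M ?D"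
      using plus_emeasure[of "G k" M ?D] Gk GS sub_G by (simp add: Un_absorb1)
    then have "c * emeasure M (G (Suc k)) + (\<integral>\<^sup>+\<omega>\<in>space M - G (Suc k). Z (Suc k) \<omega> \<partial>M)
        \<le> c * emeasure M (G k) + ((\<integral>\<^sup>+\<omega>\<in>?D. Z (Suc k) \<omega> \<partial>M)
          + (\<integral>\<^sup>+\<omega>\<in>space M - G (Suc k). Z (Suc k) \<omega> \<partial>M))"
      using add_right_mono[OF D] by (simp add: distrib_left add.assoc add_left_mono)
    also have "\<dots> = c * emeasure M (G k) + (\<integral>\<^sup>+\<omega>\<in>space M - G k. Z (Suc k) \<omega> \<partial>M)"
      unfolding eq by (subst split) (use Suc.prems Gk GS in auto)
    \<comment> \<open>The supermartingale property is used only on the paths that have not crossed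
      by time \<open>k\<close>; the part already crossed stays frozen.\<close>
    also have "\<dots> \<le> c * emeasure M (G k) + (\<integral>\<^sup>+\<omega>\<in>space M - G k. Z k \<omega> \<partial>M)"
    proof (rule add_left_mono, rule super)
      show "space M - G k \<in> sets (F k)"
        using sets.compl_sets[OF G_F[of k]] space_F[of k] Suc.prems by simp
    qed (use Suc.prems in auto)
    also have "\<dots> \<le> (\<integral>\<^sup>+\<omega>. Z 0 \<omega> \<partial>M)" using Suc by simp
    finally show ?case .
  qed
  from this[of n] have "c * emeasure M (G n) \<le> (\<integral>\<^sup>+\<omega>. Z 0 \<omega> \<partial>M)"
    by (meson add_increasing2 order_refl order_trans zero_le)
  then show ?thesis by (simp add: G_def)
qed

text \<open>Since \<open>g\<close> is \<open>F\<close>-measurable, \<open>h\<close> may be replaced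
  under the integral by its conditional expectation. All functions take values in
  \<open>ennreal\<close>, so the product needs no integrability check.\<close>

lemma (in sigma_finite_subalgebra) nn_integral_mult_le_of_nn_cond_exp_le:
  assumes "g \<in> borel_measurable F" "h \<in> borel_measurable M"
    and "AE \<omega> in M. nn_cond_exp M F h \<omega> \<le> u \<omega>"
  shows "(\<integral>\<^sup>+\<omega>. g \<omega> * h \<omega> \<partial>M) \<le> (\<integral>\<^sup>+\<omega>. g \<omega> * u \<omega> \<partial>M)"
proof -
  have "(\<integral>\<^sup>+\<omega>. g \<omega> * h \<omega> \<partial>M) = (\<integral>\<^sup>+\<omega>. g \<omega> * nn_cond_exp M F h \<omega> \<partial>M)"
    by (rule nn_cond_exp_intg[symmetric]) fact+
  also have "\<dots> \<le> (\<integral>\<^sup>+\<omega>. g \<omega> * u \<omega> \<partial>M)"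
    by (rule nn_integral_mono_AE) (use assms(3) in \<open>auto elim!: eventually_mono intro: mult_left_mono\<close>)
  finally show ?thesis .
qed

theorem theorem2p6:
  fixes M :: "'a measure"
    and n :: nat
    and F :: "nat \<Rightarrow> 'a measure"
    and \<xi> V :: "nat \<Rightarrow> 'a \<Rightarrow> real"
    and f :: "real \<Rightarrow> real"
    and l x v :: real
  assumes "n \<ge> 1"
    and "supermartingale_differences M n F \<xi>"
    and "\<And>i. i \<in> {1..n} \<Longrightarrow> V (i - 1) \<in> borel_measurable (F (i - 1))"
    and "\<And>i \<omega>. i \<in> {1..n} \<Longrightarrow> \<omega> \<in> space M \<Longrightarrow> V (i - 1) \<omega> > 0"
    and "l > 0"
    and "\<And>t. t > 0 \<Longrightarrow> f t > 0"
    and "\<And>i. i \<in> {1..n} \<Longrightarrow>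
      AE \<omega> in M. nn_cond_exp M (F (i - 1)) (\<lambda>\<omega>. ennreal (exp (l * \<xi> i \<omega>))) \<omega>
        \<le> ennreal (exp (f l * V (i - 1) \<omega>))"
    and "x > 0" and "v > 0"
  shows "measure M {\<omega> \<in> space M. \<exists>k\<in>{1..n}.
      (\<Sum>i=1..k. \<xi> i \<omega>) \<ge> x \<and> (\<Sum>i=1..k. V (i - 1) \<omega>) \<le> v\<^sup>2}
    \<le> exp (- l * x + f l * v\<^sup>2)"
proof -
  interpret supermartingale_differences M n F \<xi> by fact
  define S where "S k \<omega> = (\<Sum>i=1..k. \<xi> i \<omega>)" for k \<omega>
  define W where "W k \<omega> = (\<Sum>i=1..k. V (i - 1) \<omega>)" for k \<omega>
  define Z where "Z k \<omega> = ennreal (exp (l * S k \<omega> - f l * W k \<omega>))" for k \<omega>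
  define c where "c = exp (l * x - f l * v\<^sup>2)"
  have F_mono: "g \<in> borel_measurable (F j)"
    if "g \<in> borel_measurable (F i)" "i \<le> j" "j \<le> n" for g :: "'a \<Rightarrow> real" and i j
  proof (rule measurable_from_subalg)
    show "subalgebra (F j) (F i)"
      using subalgebra_F[of i] subalgebra_F[of j] sets_F_mono[of i j] that
      by (simp add: subalgebra_def)
  qed fact
  have S_meas: "S k \<in> borel_measurable (F k)" if "k \<le> n" for k
    unfolding S_def by (intro borel_measurable_sum F_mono[OF diff_adapted]) (use that in auto)
  \<comment> \<open>Predictability: \<open>W (Suc k)\<close> ends with the summand
    \<open>V k\<close>, so it is already known at time \<open>k\<close>.\<close>
  have W_pred_meas: "W (Suc k) \<in> borel_measurable (F k)" if "k < n" for k
    unfolding W_def by (intro borel_measurable_sum F_mono[OF assms(3)]) (use that in auto)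
  have W_meas: "W k \<in> borel_measurable (F k)" if "k \<le> n" for k
    unfolding W_def by (intro borel_measurable_sum F_mono[OF assms(3)]) (use that in auto)
  have Z_meas: "Z k \<in> borel_measurable (F k)" if "k \<le> n" for k
    unfolding Z_def using S_meas[OF that] W_meas[OF that] by measurable
  have super: "(\<integral>\<^sup>+\<omega>\<in>A. Z (Suc k) \<omega> \<partial>M) \<le> (\<integral>\<^sup>+\<omega>\<in>A. Z k \<omega> \<partial>M)"
    if k: "k < n" and A: "A \<in> sets (F k)" for k A
  proof -
    interpret sub: finite_measure_subalgebra M "F k"
      by unfold_locales (use k subalgebra_F in auto)
    \<comment> \<open>\<open>g\<close> collects the factors of \<open>Z (Suc k)\<close> known at
      time \<open>k\<close>: \<open>S\<close> stops at \<open>k\<close>, while \<open>W\<close> runs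
      to \<open>Suc k\<close>. Only \<open>h\<close> remains. Replacing \<open>h\<close> by its
      bound \<open>exp (f l * V k \<omega>)\<close> cancels the last summand of
      \<open>W (Suc k)\<close> and leaves \<open>Z k\<close>.\<close>
    define g where "g \<omega> = ennreal (exp (l * S k \<omega> - f l * W (Suc k) \<omega>)) * indicator A \<omega>" for \<omega>
    define h where "h \<omega> = ennreal (exp (l * \<xi> (Suc k) \<omega>))" for \<omega>
    have "g \<in> borel_measurable (F k)"
      unfolding g_def using S_meas[OF less_imp_le[OF k]] W_pred_meas[OF k] A by simp
    moreover have "\<xi> (Suc k) \<in> borel_measurable M"
      by (rule measurable_from_subalg[OF subalgebra_F diff_adapted]) (use k in auto)
    then have "h \<in> borel_measurable M"
      unfolding h_def by measurable
    moreover have "AE \<omega> in M. nn_cond_exp M (F k) h \<omega> \<le> ennreal (exp (f l * V k \<omega>))"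
      using assms(7)[of "Suc k"] k by (simp add: h_def[abs_def])
    ultimately have "(\<integral>\<^sup>+\<omega>. g \<omega> * h \<omega> \<partial>M) \<le> (\<integral>\<^sup>+\<omega>. g \<omega> * ennreal (exp (f l * V k \<omega>)) \<partial>M)"
      by (rule sub.nn_integral_mult_le_of_nn_cond_exp_le)
    moreover have "g \<omega> * h \<omega> = Z (Suc k) \<omega> * indicator A \<omega>" for \<omega>
      by (auto simp: g_def h_def Z_def S_def algebra_simps simp flip: ennreal_mult exp_add
          split: split_indicator)
    moreover have "g \<omega> * ennreal (exp (f l * V k \<omega>)) = Z k \<omega> * indicator A \<omega>" for \<omega>
      by (auto simp: g_def Z_def W_def algebra_simps simp flip: ennreal_mult exp_add
          split: split_indicator)
    ultimately show ?thesis by simp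
  qed
  let ?E = "{\<omega> \<in> space M. \<exists>k\<in>{1..n}. x \<le> S k \<omega> \<and> W k \<omega> \<le> v\<^sup>2}"
  let ?G = "{\<omega> \<in> space M. \<exists>k\<le>n. ennreal c \<le> Z k \<omega>}"
  have Z_M: "Z k \<in> borel_measurable M" if "k \<le> n" for k
    by (rule measurable_from_subalg[OF subalgebra_F Z_meas]) (use that in auto)
  \<comment> \<open>For the final comparison of \<open>?E\<close> with \<open>?G\<close> by
    monotonicity, measurability of the larger set suffices.\<close>
  have "?G = (\<Union>k\<in>{..n}. {\<omega> \<in> space M. ennreal c \<le> Z k \<omega>})"
    by auto
  also have "\<dots> \<in> sets M"
    by (intro sets.finite_UN) (use Z_M in auto)
  finally have G_M: "?G \<in> sets M" .
  have E_G: "?E \<subseteq> ?G"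
  proof
    fix \<omega> assume "\<omega> \<in> ?E"
    then obtain k where k: "\<omega> \<in> space M" "k \<le> n" "x \<le> S k \<omega>" "W k \<omega> \<le> v\<^sup>2"
      by auto
    \<comment> \<open>Positivity of \<open>l\<close> carries over the lower bound on
      \<open>S k\<close>, and positivity of \<open>f l\<close> the upper bound on
      \<open>W k\<close>.\<close>
    have "l * x - f l * v\<^sup>2 \<le> l * S k \<omega> - f l * W k \<omega>"
      using k assms(5) assms(6)[of l] by (intro diff_mono mult_left_mono) auto
    then have "ennreal c \<le> Z k \<omega>"
      by (simp add: c_def Z_def ennreal_leI)
    with k show "\<omega> \<in> ?G" by auto
  qed
  have "ennreal c * emeasure M ?G \<le> (\<integral>\<^sup>+\<omega>. Z 0 \<omega> \<partial>M)"
    by (rule nonneg_supermartingale_maximal_inequality[of n M F Z])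
      (use subalgebra_F sets_F_mono Z_meas super in auto)
  also have "\<dots> = 1"
    by (simp add: Z_def S_def W_def emeasure_space_1)
  finally have "ennreal (c * measure M ?G) \<le> 1"
    by (simp add: emeasure_eq_measure ennreal_mult c_def)
  then have cG: "c * measure M ?G \<le> 1"
    by simp
  have "measure M ?E \<le> measure M ?G"
    by (rule finite_measure_mono[OF E_G G_M])
  also have "\<dots> \<le> 1 / c"
    using cG by (simp add: c_def field_simps)
  also have "1 / c = exp (- l * x + f l * v\<^sup>2)"
    by (simp add: c_def flip: exp_minus inverse_eq_divide)
  finally show ?thesis
    by (simp add: S_def W_def)
qed

end
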